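(* For every $\varphi\in L^\infty(\mathbb{T})$, the weighted dual truncated Toeplitz operator $D_\varphi^{\mathcal{M}}$ is bounded on $\mathcal{M}^\perp$, and $$\|D_\varphi^{\mathcal{M}}\|=\|\varphi\|_\infty .$$
   Context: $\mathbb{D}$ is the open unit disk, $\mathbb{T}=\partial\mathbb{D}$, and $L^2(\mathbb{T})$ is taken with respect to normalized Lebesgue measure $m$, with inner product linear in the first variable. $H^2\subset L^2(\mathbb{T})$ is the Hardy space (functions with vanishing negative Fourier coefficients, also viewed as analytic functions on $\mathbb{D}$). For $f\in H^2$, $S^*f=(f-f(0))/z$. For an inner function $u$, $\mathcal{K}_u=H^2\ominus uH^2$. A closed subspace $\mathcal{M}\subset H^2$ is nearly $S^*$-invariant if $f\in\mathcal{M}$, $f(0)=0$ imply $S^*f\in\mathcal{M}$. Setting: $\mathcal{M}=h\mathcal{K}_u$ is a nonzero proper closed nearly $S^*$-invariant subspace of $H^2$, where $u$ is a nonconstant inner function with $u(0)=0$ and $h\in\mathcal{M}$ is the extremal function of $\mathcal{M}$: $\|h\|_2=1$, $h(0)>0$, $h\perp\{f\in\mathcal{M}:f(0)=0\}$, and multiplication by $h$ is an isometry from $\mathcal{K}_u$ onto $\mathcal{M}$. The orthogonal complement is $\mathcal{M}^\perp=L^2(\mathbb{T})\ominus\mathcal{M}$, and $P_{\mathcal{M}^\perp}$ is the orthogonal projection of $L^2(\mathbb{T})$ onto it. $M_\varphi f=\varphi f$ on $L^2(\mathbb{T})$. For $\varphi\in L^\infty(\mathbb{T})$, the weighted dual truncated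 Toeplitz operator is $D_\varphi^{\mathcal{M}}:\mathcal{M}^\perp\to\mathcal{M}^\perp$, $D_\varphi^{\mathcal{M}}f=P_{\mathcal{M}^\perp}(\varphi f)$. *)

theory Defs
  imports "HOL-Probability.Probability"
begin

text \<open>
  Elements of \<open>L\<^sup>2\<close> of the circle are represented by functions, to be identified when they
  agree almost everywhere. The norms below are therefore seminorms on representatives, and all
  spaces are unions of almost-everywhere classes (for closed subspaces this follows from
  closedness, applied to constant sequences). Values off the unit circle are irrelevant.
\<close>

definition circle_measure :: "complex measure" where
  "circle_measure =
     distr (uniform_measure lborel {0..<2 * pi}) (restrict_space borel (sphere 0 1)) cis"

definition L2 :: "(complex \<Rightarrow> complex) set" where
  "L2 = {f \<in> borel_measurable circle_measure.
           integrable circle_measure (\<lambda>z. (cmod (f z))\<^sup>2)}"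

definition l2_inner :: "(complex \<Rightarrow> complex) \<Rightarrow> (complex \<Rightarrow> complex) \<Rightarrow> complex" where
  "l2_inner f g = (LINT z|circle_measure. f z * cnj (g z))"

definition l2_norm :: "(complex \<Rightarrow> complex) \<Rightarrow> real" where
  "l2_norm f = sqrt (LINT z|circle_measure. (cmod (f z))\<^sup>2)"

definition linf_norm :: "(complex \<Rightarrow> complex) \<Rightarrow> real" where
  "linf_norm \<phi> = real_of_ereal (esssup circle_measure (\<lambda>z. ereal (cmod (\<phi> z))))"

definition Linf :: "(complex \<Rightarrow> complex) set" where
  "Linf = {\<phi> \<in> borel_measurable circle_measure.
             esssup circle_measure (\<lambda>z. ereal (cmod (\<phi> z))) < \<infinity>}"

definition fourier_coeff :: "(complex \<Rightarrow> complex) \<Rightarrow> int \<Rightarrow> complex" where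
  "fourier_coeff f n = (LINT z|circle_measure. f z * cnj (z powi n))"

definition H2 :: "(complex \<Rightarrow> complex) set" where
  "H2 = {f \<in> L2. \<forall>n<0. fourier_coeff f n = 0}"

text \<open>
  The analytic function on the unit disk with boundary function \<open>f \<in> H\<^sup>2\<close>, used only for
  arguments of modulus less than 1. The value of a Hardy space function at 0 always refers to
  this extension, never to the representative.
\<close>
definition disk_ext :: "(complex \<Rightarrow> complex) \<Rightarrow> complex \<Rightarrow> complex" where
  "disk_ext f w = (\<Sum>n. fourier_coeff f (int n) * w ^ n)"

definition backward_shift :: "(complex \<Rightarrow> complex) \<Rightarrow> complex \<Rightarrow> complex" where
  "backward_shift f = (\<lambda>z. (f z - disk_ext f 0) / z)"

text \<open>Inner functions are given by their (unimodular) boundary functions.\<close>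
definition inner_function :: "(complex \<Rightarrow> complex) \<Rightarrow> bool" where
  "inner_function u \<longleftrightarrow> u \<in> H2 \<inter> Linf \<and> (AE z in circle_measure. cmod (u z) = 1)"

definition l2_orth :: "(complex \<Rightarrow> complex) set \<Rightarrow> (complex \<Rightarrow> complex) set" where
  "l2_orth V = {f \<in> L2. \<forall>g\<in>V. l2_inner f g = 0}"

text \<open>The set \<open>h V\<close> of products, saturated under almost-everywhere equality.\<close>
definition mult_image ::
  "(complex \<Rightarrow> complex) \<Rightarrow> (complex \<Rightarrow> complex) set \<Rightarrow> (complex \<Rightarrow> complex) set" where
  "mult_image h V = {f \<in> borel_measurable circle_measure.
                       \<exists>k\<in>V. AE z in circle_measure. f z = h z * k z}"

definition model_space :: "(complex \<Rightarrow> complex) \<Rightarrow> (complex \<Rightarrow> complex) set" where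
  "model_space u = H2 \<inter> l2_orth (mult_image u H2)"

definition closed_l2_subspace :: "(complex \<Rightarrow> complex) set \<Rightarrow> bool" where
  "closed_l2_subspace V \<longleftrightarrow>
     V \<subseteq> L2 \<and> (\<lambda>z. 0) \<in> V \<and>
     (\<forall>f\<in>V. \<forall>g\<in>V. (\<lambda>z. f z + g z) \<in> V) \<and>
     (\<forall>c. \<forall>f\<in>V. (\<lambda>z. c * f z) \<in> V) \<and>
     (\<forall>F f. (\<forall>n. F n \<in> V) \<and> f \<in> L2 \<and> (\<lambda>n. l2_norm (\<lambda>z. F n z - f z)) \<longlonglongrightarrow> 0
        \<longrightarrow> f \<in> V)"

definition nearly_invariant :: "(complex \<Rightarrow> complex) set \<Rightarrow> bool" where
  "nearly_invariant V \<longleftrightarrow> (\<forall>f\<in>V. disk_ext f 0 = 0 \<longrightarrow> backward_shift f \<in> V)"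

definition extremal_function :: "(complex \<Rightarrow> complex) set \<Rightarrow> (complex \<Rightarrow> complex) \<Rightarrow> bool" where
  "extremal_function V h \<longleftrightarrow>
     h \<in> V \<and> l2_norm h = 1 \<and> disk_ext h 0 \<in> \<real> \<and> Re (disk_ext h 0) > 0 \<and>
     (\<forall>f\<in>V. disk_ext f 0 = 0 \<longrightarrow> l2_inner h f = 0)"

text \<open>
  The orthogonal projection of \<open>L\<^sup>2\<close> onto a closed subspace; the choice only concerns
  the representative.
\<close>
definition l2_proj ::
  "(complex \<Rightarrow> complex) set \<Rightarrow> (complex \<Rightarrow> complex) \<Rightarrow> complex \<Rightarrow> complex" where
  "l2_proj V f = (SOME g. g \<in> V \<and> (\<lambda>z. f z - g z) \<in> l2_orth V)"

definition dual_trunc_toeplitz ::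
  "(complex \<Rightarrow> complex) set \<Rightarrow> (complex \<Rightarrow> complex) \<Rightarrow> (complex \<Rightarrow> complex) \<Rightarrow> complex \<Rightarrow> complex" where
  "dual_trunc_toeplitz M \<phi> f = l2_proj (l2_orth M) (\<lambda>z. \<phi> z * f z)"

text \<open>Bounded linear operators from \<open>V\<close> to itself, with linearity up to null sets.\<close>
definition bounded_l2_operator ::
  "(complex \<Rightarrow> complex) set \<Rightarrow> ((complex \<Rightarrow> complex) \<Rightarrow> complex \<Rightarrow> complex) \<Rightarrow> bool" where
  "bounded_l2_operator V A \<longleftrightarrow>
     (\<forall>f\<in>V. A f \<in> V) \<and>
     (\<forall>f\<in>V. \<forall>g\<in>V. AE z in circle_measure. A (\<lambda>z. f z + g z) z = A f z + A g z) \<and>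
     (\<forall>c. \<forall>f\<in>V. AE z in circle_measure. A (\<lambda>z. c * f z) z = c * A f z) \<and>
     (\<exists>C. \<forall>f\<in>V. l2_norm (A f) \<le> C * l2_norm f)"

definition l2_operator_norm ::
  "(complex \<Rightarrow> complex) set \<Rightarrow> ((complex \<Rightarrow> complex) \<Rightarrow> complex \<Rightarrow> complex) \<Rightarrow> real" where
  "l2_operator_norm V A = (SUP f\<in>{f \<in> V. l2_norm f \<le> 1}. l2_norm (A f))"

end

theory Submission
  imports Defs "HOL-Computational_Algebra.Polynomial"
begin

text \<open>
  Boundedness and the upper estimate hold because an orthogonal projection is a contraction and
  multiplication by \<open>\<phi>\<close> has norm at most \<open>linf_norm \<phi>\<close>. The projection onto \<open>l2_orth M\<close> exists because
  \<open>M\<close> is closed and \<open>L\<^sup>2\<close> is complete (\<open>closed_l2_subspace_decomposition\<close>).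

  For the lower estimate let \<open>C\<close> be the norm of the operator. If \<open>f\<close> is orthogonal to \<open>M\<close>, the projection
  has no effect on the inner product of \<open>\<phi> f\<close> with \<open>f\<close>, so the integral of \<open>\<phi> |f|\<^sup>2\<close> has modulus at most
  \<open>C\<close> times the integral of \<open>|f|\<^sup>2\<close> (\<open>dual_trunc_toeplitz_quadratic_form\<close>). This depends on \<open>f\<close> only through
  \<open>|f|\<close>, and \<open>|f|\<close> is almost arbitrary: \<open>M\<close> lies in the Hardy space, and any polynomial \<open>p\<close> becomes
  orthogonal to the Hardy space after multiplication by a sufficiently negative power of \<open>z\<close>, which is
  unimodular on the circle (\<open>conj_power_poly_orth_H2\<close>). By the Stone-Weierstrass theorem the moduli of
  polynomials approximate every nonnegative continuous function on the circle uniformly, hence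
  indicators of compact sets boundedly and pointwise (\<open>poly_modulus_indicator\<close>). In the limit the
  average of \<open>\<phi>\<close> over any compact set of positive measure, and then over any measurable set of
  positive measure, has modulus at most \<open>C\<close>. This forces \<open>|\<phi>| \<le> C\<close> almost everywhere
  (\<open>AE_bound_from_quadratic_forms\<close>), that is, \<open>linf_norm \<phi> \<le> C\<close>.
\<close>

section \<open>Square-integrable functions on the circle\<close>

lemma prob_space_circle_measure: "prob_space circle_measure"
proof -
  have "prob_space (uniform_measure lborel {0..<2 * pi})"
    by (intro prob_space_uniform_measure) auto
  moreover have "cis \<in> borel_measurable borel"
    by (intro borel_measurable_continuous_onI continuous_intros)
  then have "cis \<in> measurable (uniform_measure lborel {0..<2 * pi})
      (restrict_space borel (sphere 0 1))"
    by (intro measurable_restrict_space2) auto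
  ultimately show ?thesis
    unfolding circle_measure_def by (rule prob_space.prob_space_distr)
qed

interpretation circle: prob_space circle_measure
  by (rule prob_space_circle_measure)

lemma space_circle_measure [simp]: "space circle_measure = sphere 0 1"
  by (simp add: circle_measure_def space_restrict_space)

lemma sets_circle_measure [measurable_cong]:
  "sets circle_measure = sets (restrict_space borel (sphere 0 1))"
  by (simp add: circle_measure_def)

lemma AE_circle_cmod: "AE z in circle_measure. cmod z = 1"
  by (rule AE_I2) simp

lemma borel_measurable_circle:
  "f \<in> borel_measurable borel \<Longrightarrow> f \<in> borel_measurable circle_measure"
  using measurable_restrict_space1 measurable_cong_sets[OF sets_circle_measure refl] by blast

lemma borel_measurable_cnj [measurable (raw)]:
  "f \<in> borel_measurable N \<Longrightarrow> (\<lambda>x. cnj (f x)) \<in> borel_measurable N"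
  by (rule borel_measurable_continuous_on[where f = cnj]) (auto intro: continuous_intros)

lemma L2_measurable [measurable_dest]: "f \<in> L2 \<Longrightarrow> f \<in> borel_measurable circle_measure"
  by (simp add: L2_def)

lemma L2_integrable_sq: "f \<in> L2 \<Longrightarrow> integrable circle_measure (\<lambda>z. (cmod (f z))\<^sup>2)"
  by (simp add: L2_def)

lemma L2_dominated:
  assumes [measurable]: "f \<in> borel_measurable circle_measure" and "g \<in> L2"
    and "AE z in circle_measure. cmod (f z) \<le> c * cmod (g z)"
  shows "f \<in> L2"
proof -
  have "integrable circle_measure (\<lambda>z. c\<^sup>2 * (cmod (g z))\<^sup>2)"
    using assms by (simp add: L2_def)
  then have "integrable circle_measure (\<lambda>z. (cmod (f z))\<^sup>2)"
  proof (rule Bochner_Integration.integrable_bound)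
    show "AE z in circle_measure. norm ((cmod (f z))\<^sup>2) \<le> norm (c\<^sup>2 * (cmod (g z))\<^sup>2)"
      using assms(3)
    proof eventually_elim
      case (elim z)
      then show ?case
        using power_mono[OF elim, of 2] by (simp add: power_mult_distrib)
    qed
  qed simp
  then show ?thesis by (simp add: L2_def)
qed

lemma L2_bounded:
  assumes "f \<in> borel_measurable circle_measure"
    and "AE z in circle_measure. cmod (f z) \<le> c"
  shows "f \<in> L2"
  by (rule L2_dominated[where g = "\<lambda>_. 1" and c = c]) (use assms in \<open>auto simp: L2_def\<close>)

lemma L2_cmult: "f \<in> L2 \<Longrightarrow> (\<lambda>z. c * f z) \<in> L2"
  by (rule L2_dominated[where g = f and c = "cmod c"]) (auto simp: norm_mult)

lemma L2_uminus: "f \<in> L2 \<Longrightarrow> (\<lambda>z. - f z) \<in> L2"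
  using L2_cmult[of f "-1"] by simp

lemma L2_add:
  assumes f: "f \<in> L2" and g: "g \<in> L2"
  shows "(\<lambda>z. f z + g z) \<in> L2"
proof -
  note [measurable] = L2_measurable[OF f] L2_measurable[OF g]
  have "integrable circle_measure (\<lambda>z. 2 * (cmod (f z))\<^sup>2 + 2 * (cmod (g z))\<^sup>2)"
    using assms by (simp add: L2_def)
  then have "integrable circle_measure (\<lambda>z. (cmod (f z + g z))\<^sup>2)"
  proof (rule Bochner_Integration.integrable_bound)
    have "(cmod (f z + g z))\<^sup>2 \<le> 2 * (cmod (f z))\<^sup>2 + 2 * (cmod (g z))\<^sup>2" for z
      using power_mono[OF norm_triangle_ineq[of "f z" "g z"], of 2] sum_squares_bound[of "cmod (f z)" "cmod (g z)"]
      by (simp add: power2_sum)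
    then show "AE z in circle_measure. norm ((cmod (f z + g z))\<^sup>2)
        \<le> norm (2 * (cmod (f z))\<^sup>2 + 2 * (cmod (g z))\<^sup>2)" by simp
  qed simp
  then show ?thesis by (simp add: L2_def)
qed

lemma L2_diff: "f \<in> L2 \<Longrightarrow> g \<in> L2 \<Longrightarrow> (\<lambda>z. f z - g z) \<in> L2"
  using L2_add[OF _ L2_uminus[of g]] by simp

lemma L2_integrable_mult:
  assumes f: "f \<in> L2" and g: "g \<in> L2"
  shows "integrable circle_measure (\<lambda>z. f z * cnj (g z))"
proof -
  note [measurable] = L2_measurable[OF f] L2_measurable[OF g]
  have "integrable circle_measure (\<lambda>z. (cmod (f z))\<^sup>2 + (cmod (g z))\<^sup>2)"
    using assms by (simp add: L2_def)
  then show ?thesis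
  proof (rule Bochner_Integration.integrable_bound)
    have "cmod (f z * cnj (g z)) \<le> (cmod (f z))\<^sup>2 + (cmod (g z))\<^sup>2" for z
    proof -
      have "2 * (cmod (f z) * cmod (g z)) \<le> (cmod (f z))\<^sup>2 + (cmod (g z))\<^sup>2"
        using sum_squares_bound[of "cmod (f z)" "cmod (g z)"] by simp
      moreover have "0 \<le> cmod (f z) * cmod (g z)" by simp
      ultimately show ?thesis unfolding norm_mult complex_mod_cnj by linarith
    qed
    then show "AE z in circle_measure. cmod (f z * cnj (g z))
        \<le> norm ((cmod (f z))\<^sup>2 + (cmod (g z))\<^sup>2)" by simp
  qed simp
qed

lemma l2_norm_nonneg: "0 \<le> l2_norm f"
  by (simp add: l2_norm_def)

lemma l2_norm_sq: "(l2_norm f)\<^sup>2 = (LINT z|circle_measure. (cmod (f z))\<^sup>2)"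
  by (simp add: l2_norm_def)

lemma l2_norm_cmult: "l2_norm (\<lambda>z. c * f z) = cmod c * l2_norm f"
  by (simp add: l2_norm_def norm_mult power_mult_distrib real_sqrt_mult)

lemma l2_norm_eq_0_AE:
  assumes "f \<in> L2" and "l2_norm f = 0"
  shows "AE z in circle_measure. f z = 0"
proof -
  have "(LINT z|circle_measure. (cmod (f z))\<^sup>2) = 0"
    using assms(2) l2_norm_sq[of f] by simp
  then have "AE z in circle_measure. (cmod (f z))\<^sup>2 = 0"
    using integral_nonneg_eq_0_iff_AE[OF L2_integrable_sq[OF assms(1)]] by simp
  then show ?thesis by simp
qed

lemma l2_norm_mono:
  assumes "f \<in> borel_measurable circle_measure" "g \<in> L2"
    and "AE z in circle_measure. cmod (f z) \<le> c * cmod (g z)" and "0 \<le> c"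
  shows "l2_norm f \<le> c * l2_norm g"
proof -
  have "f \<in> L2" by (rule L2_dominated) (use assms in auto)
  have "(LINT z|circle_measure. (cmod (f z))\<^sup>2) \<le> (LINT z|circle_measure. c\<^sup>2 * (cmod (g z))\<^sup>2)"
  proof (rule integral_mono_AE)
    show "AE z in circle_measure. (cmod (f z))\<^sup>2 \<le> c\<^sup>2 * (cmod (g z))\<^sup>2"
      using assms(3)
    proof eventually_elim
      case (elim z)
      then show ?case
        using power_mono[OF elim, of 2] by (simp add: power_mult_distrib)
    qed
  qed (intro integrable_mult_right L2_integrable_sq assms \<open>f \<in> L2\<close>)+
  then have "(l2_norm f)\<^sup>2 \<le> (c * l2_norm g)\<^sup>2"
    by (simp add: l2_norm_sq power_mult_distrib)
  then show ?thesis
    by (rule power2_le_imp_le) (simp add: assms(4) l2_norm_nonneg)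
qed

lemma l2_inner_add_left: "f \<in> L2 \<Longrightarrow> g \<in> L2 \<Longrightarrow> k \<in> L2 \<Longrightarrow>
    l2_inner (\<lambda>z. f z + g z) k = l2_inner f k + l2_inner g k"
  by (simp add: l2_inner_def distrib_right L2_integrable_mult)

lemma l2_inner_diff_left: "f \<in> L2 \<Longrightarrow> g \<in> L2 \<Longrightarrow> k \<in> L2 \<Longrightarrow>
    l2_inner (\<lambda>z. f z - g z) k = l2_inner f k - l2_inner g k"
  by (simp add: l2_inner_def left_diff_distrib L2_integrable_mult)

lemma l2_inner_cmult_left: "l2_inner (\<lambda>z. c * f z) k = c * l2_inner f k"
  by (simp add: l2_inner_def mult.assoc)

lemma l2_inner_commute: "l2_inner g f = cnj (l2_inner f g)"
  unfolding l2_inner_def Bochner_Integration.integral_cnj[symmetric] by (simp add: mult.commute)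

lemma l2_inner_self: "l2_inner f f = of_real ((l2_norm f)\<^sup>2)"
  by (simp add: l2_inner_def l2_norm_sq complex_norm_square[symmetric] flip: integral_complex_of_real)

lemma l2_inner_diff_right: "f \<in> L2 \<Longrightarrow> g \<in> L2 \<Longrightarrow> k \<in> L2 \<Longrightarrow>
    l2_inner k (\<lambda>z. f z - g z) = l2_inner k f - l2_inner k g"
  by (simp add: l2_inner_def ring_distribs L2_integrable_mult)

lemma l2_norm_diff_sq:
  assumes "f \<in> L2" "g \<in> L2"
  shows "(l2_norm (\<lambda>z. f z - g z))\<^sup>2 = (l2_norm f)\<^sup>2 - 2 * Re (l2_inner f g) + (l2_norm g)\<^sup>2"
proof -
  have d: "(\<lambda>z. f z - g z) \<in> L2" by (rule L2_diff) fact+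
  have "complex_of_real ((l2_norm (\<lambda>z. f z - g z))\<^sup>2) =
      (l2_inner f f - l2_inner f g) - (l2_inner g f - l2_inner g g)"
    unfolding l2_inner_self[symmetric] l2_inner_diff_left[OF assms d]
    using assms by (simp only: l2_inner_diff_right)
  then have "(l2_norm (\<lambda>z. f z - g z))\<^sup>2 =
      Re ((l2_inner f f - l2_inner f g) - (l2_inner g f - l2_inner g g))"
    by (metis Re_complex_of_real)
  moreover have "Re (l2_inner g f) = Re (l2_inner f g)"
    by (subst l2_inner_commute) simp
  ultimately show ?thesis by (simp add: l2_inner_self)
qed

lemma l2_Cauchy_Schwarz:
  assumes f: "f \<in> L2" and g: "g \<in> L2"
  shows "cmod (l2_inner f g) \<le> l2_norm f * l2_norm g"
proof -
  note [measurable] = L2_measurable[OF f] L2_measurable[OF g]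
  have nn: "(\<integral>\<^sup>+z. ennreal (cmod (k z)) ^ 2 \<partial>circle_measure) = ennreal ((l2_norm k)\<^sup>2)"
    if "k \<in> L2" for k
    using nn_integral_eq_integral[OF L2_integrable_sq[OF that]]
    by (simp add: l2_norm_sq ennreal_power)
  have "ennreal (cmod (l2_inner f g)) \<le> (\<integral>\<^sup>+z. ennreal (norm (f z * cnj (g z))) \<partial>circle_measure)"
    unfolding l2_inner_def by (rule integral_norm_bound_ennreal[OF L2_integrable_mult[OF f g]])
  then have "(ennreal (cmod (l2_inner f g)))\<^sup>2 \<le>
      (\<integral>\<^sup>+z. ennreal (cmod (f z)) * ennreal (cmod (g z)) \<partial>circle_measure)\<^sup>2"
    by (intro power_mono) (auto simp: norm_mult ennreal_mult)
  also have "\<dots> \<le> ennreal ((l2_norm f)\<^sup>2) * ennreal ((l2_norm g)\<^sup>2)"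
    unfolding nn[OF f, symmetric] nn[OF g, symmetric]
    by (rule Cauchy_Schwarz_nn_integral) auto
  finally have "(cmod (l2_inner f g))\<^sup>2 \<le> (l2_norm f * l2_norm g)\<^sup>2"
    by (simp add: ennreal_power power_mult_distrib flip: ennreal_mult)
  then show ?thesis
    by (rule power2_le_imp_le) (simp add: l2_norm_nonneg)
qed

section \<open>Completeness and orthogonal decomposition\<close>

lemma L2_Fatou:
  assumes F: "\<And>n. F n \<in> L2" and f [measurable]: "f \<in> borel_measurable circle_measure"
    and lim: "AE z in circle_measure. (\<lambda>n. F n z) \<longlonglongrightarrow> f z"
    and le: "\<And>n. (l2_norm (F n))\<^sup>2 \<le> B"
  shows "f \<in> L2" and "(l2_norm f)\<^sup>2 \<le> B"
proof -
  note [measurable] = L2_measurable[OF F]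
  have B: "0 \<le> B" using le[of 0] by (rule order_trans[rotated]) simp
  have "(\<integral>\<^sup>+z. ennreal ((cmod (f z))\<^sup>2) \<partial>circle_measure) =
      (\<integral>\<^sup>+z. liminf (\<lambda>n. ennreal ((cmod (F n z))\<^sup>2)) \<partial>circle_measure)"
  proof (rule nn_integral_cong_AE)
    show "AE z in circle_measure. ennreal ((cmod (f z))\<^sup>2) = liminf (\<lambda>n. ennreal ((cmod (F n z))\<^sup>2))"
      using lim
    proof eventually_elim
      case (elim z)
      then have "(\<lambda>n. ennreal ((cmod (F n z))\<^sup>2)) \<longlonglongrightarrow> ennreal ((cmod (f z))\<^sup>2)"
        by (intro tendsto_intros)
      then show ?case
        by (intro lim_imp_Liminf[symmetric]) auto
    qed
  qed
  also have "\<dots> \<le> liminf (\<lambda>n. \<integral>\<^sup>+z. ennreal ((cmod (F n z))\<^sup>2) \<partial>circle_measure)"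
    by (rule nn_integral_liminf) simp
  also have "(\<lambda>n. \<integral>\<^sup>+z. ennreal ((cmod (F n z))\<^sup>2) \<partial>circle_measure) =
      (\<lambda>n. ennreal ((l2_norm (F n))\<^sup>2))"
    using nn_integral_eq_integral[OF L2_integrable_sq[OF F]] by (simp add: l2_norm_sq)
  also have "liminf (\<lambda>n. ennreal ((l2_norm (F n))\<^sup>2)) \<le> ennreal B"
    by (rule Liminf_le) (simp_all add: le ennreal_leI)
  finally have *: "(\<integral>\<^sup>+z. ennreal ((cmod (f z))\<^sup>2) \<partial>circle_measure) \<le> ennreal B" .
  then show "f \<in> L2"
    by (auto simp: L2_def integrable_iff_bounded intro: le_less_trans)
  from nn_integral_eq_integral[OF L2_integrable_sq[OF this]] * show "(l2_norm f)\<^sup>2 \<le> B"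
    by (simp add: l2_norm_sq B)
qed

text \<open>
  The arithmetic-geometric mean inequality with a free weight \<open>a\<close>, integrated over a space of total
  mass 1. Choosing \<open>a\<close> of the order of the \<open>L\<^sup>2\<close> norm makes the \<open>L\<^sup>1\<close> norms of the increments of a
  rapidly convergent sequence summable.
\<close>
lemma L2_norm_integral_le:
  assumes f: "f \<in> L2" and a: "0 < a"
  shows "(LINT z|circle_measure. cmod (f z)) \<le> (a + (l2_norm f)\<^sup>2 / a) / 2"
    and "integrable circle_measure (\<lambda>z. cmod (f z))"
proof -
  note [measurable] = L2_measurable[OF f]
  have le: "cmod (f z) \<le> (a + (cmod (f z))\<^sup>2 / a) / 2" for z
    using a sum_squares_bound[of a "cmod (f z)"] by (simp add: field_simps power2_eq_square)
  have int: "integrable circle_measure (\<lambda>z. (a + (cmod (f z))\<^sup>2 / a) / 2)"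
    by (intro integrable_divide_zero Bochner_Integration.integrable_add L2_integrable_sq f) simp
  then show i: "integrable circle_measure (\<lambda>z. cmod (f z))"
    by (rule Bochner_Integration.integrable_bound) (use le in \<open>auto intro: order_trans[OF _ abs_ge_self]\<close>)
  have "(LINT z|circle_measure. cmod (f z)) \<le> (LINT z|circle_measure. (a + (cmod (f z))\<^sup>2 / a) / 2)"
    by (intro integral_mono i int le)
  also have "\<dots> = (a + (l2_norm f)\<^sup>2 / a) / 2"
    by (simp add: l2_norm_sq L2_integrable_sq[OF f] circle.prob_space[simplified])
  finally show "(LINT z|circle_measure. cmod (f z)) \<le> (a + (l2_norm f)\<^sup>2 / a) / 2" .
qed

text \<open>
  The Riesz-Fischer argument. With geometric rates the increments of the sequence have summable
  \<open>L\<^sup>1\<close> norms, so they are absolutely summable at almost every point and the sequence converges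
  there; Fatou's lemma, applied to \<open>F m - F n\<close> as \<open>m\<close> grows, passes the rates on to the limit.
\<close>
lemma L2_complete:
  assumes F: "\<And>n. F n \<in> L2"
    and Cauchy: "\<And>n m. n \<le> m \<Longrightarrow> (l2_norm (\<lambda>z. F m z - F n z))\<^sup>2 \<le> C / 4 ^ n"
  obtains f where "f \<in> L2" and "AE z in circle_measure. (\<lambda>n. F n z) \<longlonglongrightarrow> f z"
    and "\<And>n. (l2_norm (\<lambda>z. F n z - f z))\<^sup>2 \<le> C / 4 ^ n"
proof -
  note [measurable] = L2_measurable[OF F]
  have C: "0 \<le> C" using Cauchy[of 0 0] by (auto intro: order_trans[rotated])
  define d where "d n z = cmod (F (Suc n) z - F n z)" for n z
  have [measurable]: "d n \<in> borel_measurable circle_measure" for n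
    unfolding d_def by simp
  have d1: "(\<integral>\<^sup>+z. ennreal (d n z) \<partial>circle_measure) \<le> ennreal ((1 + C) / 2 * (1/2) ^ n)" for n
  proof -
    have D: "(\<lambda>z. F (Suc n) z - F n z) \<in> L2" by (rule L2_diff[OF F F])
    \<comment> \<open>The weight \<open>2\<^bsup>-n\<^esup>\<close> balances the two terms, since the squared norm is at most \<open>C / 4\<^bsup>n\<^esup>\<close>.\<close>
    have "(LINT z|circle_measure. d n z) \<le>
        ((1/2)^n + (l2_norm (\<lambda>z. F (Suc n) z - F n z))\<^sup>2 / (1/2)^n) / 2"
      unfolding d_def by (rule L2_norm_integral_le[OF D]) simp
    also have "\<dots> \<le> ((1/2)^n + (C / 4 ^ n) / (1/2)^n) / 2"
      by (intro divide_right_mono add_left_mono Cauchy) auto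
    also have "(C / 4 ^ n) / (1/2)^n = C * (1/2)^n"
      using power_mult_distrib[of "2::real" 2 n] by (simp add: power_one_over)
    finally have "(LINT z|circle_measure. d n z) \<le> (1 + C) / 2 * (1/2)^n"
      by (simp add: field_simps)
    then show ?thesis
      using L2_norm_integral_le(2)[OF D, of 1]
      by (subst nn_integral_eq_integral) (auto simp: d_def[abs_def] intro: ennreal_leI)
  qed
  have "(\<integral>\<^sup>+z. (\<Sum>n. ennreal (d n z)) \<partial>circle_measure) =
      (\<Sum>n. \<integral>\<^sup>+z. ennreal (d n z) \<partial>circle_measure)"
    by (rule nn_integral_suminf) simp
  also have "\<dots> \<le> (\<Sum>n. ennreal ((1 + C) / 2 * (1/2) ^ n))"
    by (intro suminf_le d1) auto
  also have "\<dots> = ennreal (\<Sum>n. (1 + C) / 2 * (1/2) ^ n)"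
    by (rule suminf_ennreal2) (use C in \<open>auto intro!: summable_mult summable_geometric\<close>)
  also have "\<dots> < \<infinity>" by simp
  finally have "AE z in circle_measure. (\<Sum>n. ennreal (d n z)) \<noteq> \<infinity>"
    by (intro nn_integral_PInf_AE) auto
  then have conv: "AE z in circle_measure. (\<lambda>n. F n z) \<longlonglongrightarrow> lim (\<lambda>n. F n z)"
  proof eventually_elim
    case (elim z)
    then have "summable (\<lambda>n. d n z)"
      by (intro summable_suminf_not_top) (auto simp: d_def)
    then have "summable (\<lambda>n. F (Suc n) z - F n z)"
      unfolding d_def by (rule summable_norm_cancel)
    then have "convergent (\<lambda>n. \<Sum>i<n. F (Suc i) z - F i z)"
      by (simp add: summable_iff_convergent)
    then have "convergent (\<lambda>n. F n z - F 0 z)"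
      by (simp only: sum_lessThan_telescope[of "\<lambda>n. F n z"])
    then have "convergent (\<lambda>n. F n z)"
      by (simp add: convergent_diff_const_right_iff)
    then show ?case by (simp add: convergent_LIMSEQ_iff)
  qed
  define f where "f z = lim (\<lambda>n. F n z)" for z
  have [measurable]: "f \<in> borel_measurable circle_measure"
    unfolding f_def by simp
  have *: "(\<lambda>z. f z - F n z) \<in> L2" "(l2_norm (\<lambda>z. f z - F n z))\<^sup>2 \<le> C / 4 ^ n" for n
  proof -
    have lim: "AE z in circle_measure. (\<lambda>m. F (m + n) z - F n z) \<longlonglongrightarrow> f z - F n z"
      using conv by eventually_elim (rule tendsto_diff[OF LIMSEQ_ignore_initial_segment tendsto_const], simp add: f_def)
    show "(\<lambda>z. f z - F n z) \<in> L2" "(l2_norm (\<lambda>z. f z - F n z))\<^sup>2 \<le> C / 4 ^ n"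
      by (rule L2_Fatou[OF L2_diff[OF F F] _ lim Cauchy]; simp)+
  qed
  show thesis
  proof
    show "f \<in> L2" using L2_add[OF *(1)[of 0] F[of 0]] by simp
    show "AE z in circle_measure. (\<lambda>n. F n z) \<longlonglongrightarrow> f z"
      using conv by (simp add: f_def)
    show "(l2_norm (\<lambda>z. F n z - f z))\<^sup>2 \<le> C / 4 ^ n" for n
      using *(2)[of n] by (simp add: l2_norm_def norm_minus_commute)
  qed
qed

lemma l2_parallelogram:
  assumes "f \<in> L2" "g \<in> L2"
  shows "(l2_norm (\<lambda>z. f z + g z))\<^sup>2 + (l2_norm (\<lambda>z. f z - g z))\<^sup>2 =
    2 * (l2_norm f)\<^sup>2 + 2 * (l2_norm g)\<^sup>2"
proof -
  have "l2_inner f (\<lambda>z. - g z) = - l2_inner f g" "l2_norm (\<lambda>z. - g z) = l2_norm g"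
    by (simp_all add: l2_inner_def l2_norm_def)
  then show ?thesis
    using l2_norm_diff_sq[OF assms] l2_norm_diff_sq[OF assms(1) L2_uminus[OF assms(2)]] by simp
qed

lemma closed_l2_subspace_add:
  "closed_l2_subspace V \<Longrightarrow> f \<in> V \<Longrightarrow> g \<in> V \<Longrightarrow> (\<lambda>z. f z + g z) \<in> V"
  by (simp add: closed_l2_subspace_def)

lemma closed_l2_subspace_cmult:
  "closed_l2_subspace V \<Longrightarrow> f \<in> V \<Longrightarrow> (\<lambda>z. c * f z) \<in> V"
  by (simp add: closed_l2_subspace_def)

text \<open>
  The parallelogram law turns a minimizing sequence for the distance into a Cauchy sequence, because
  midpoints stay in the subspace. The almost-everywhere limit attains the infimum by Fatou's lemma.
\<close>
lemma closed_l2_subspace_minimizer: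
  assumes V: "closed_l2_subspace V" and F: "F \<in> L2"
  obtains m where "m \<in> V" and "\<And>g. g \<in> V \<Longrightarrow> (l2_norm (\<lambda>z. F z - m z))\<^sup>2 \<le> (l2_norm (\<lambda>z. F z - g z))\<^sup>2"
proof -
  have VL: "g \<in> L2" if "g \<in> V" for g using V that by (auto simp: closed_l2_subspace_def)
  define D where "D g = (l2_norm (\<lambda>z. F z - g z))\<^sup>2" for g
  define d where "d = (INF g\<in>V. D g)"
  have V0: "(\<lambda>z. 0) \<in> V" using V by (simp add: closed_l2_subspace_def)
  have bdd: "bdd_below (D ` V)" by (rule bdd_belowI2[of _ 0]) (simp add: D_def)
  have dle: "d \<le> D g" if "g \<in> V" for g
    unfolding d_def by (rule cINF_lower[OF bdd that])
  have "\<exists>g\<in>V. D g < d + 1 / 4 ^ n" for n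
    using V0 bdd cINF_less_iff[of V D "d + 1 / 4 ^ n"] by (auto simp: d_def)
  then obtain G where GV: "\<And>n. G n \<in> V" and Gd: "\<And>n. D (G n) < d + 1 / 4 ^ n"
    by metis
  have "(l2_norm (\<lambda>z. G m z - G n z))\<^sup>2 \<le> 4 / 4 ^ n" if "n \<le> m" for n m
  proof -
    have mid: "(\<lambda>z. (1/2) * (G n z + G m z)) \<in> V"
      by (intro closed_l2_subspace_cmult closed_l2_subspace_add V GV)
    have "l2_norm (\<lambda>z. (F z - G n z) + (F z - G m z)) =
        l2_norm (\<lambda>z. 2 * (F z - (1/2) * (G n z + G m z)))"
      by (simp add: algebra_simps)
    then have "(l2_norm (\<lambda>z. (F z - G n z) + (F z - G m z)))\<^sup>2 = 4 * D (\<lambda>z. (1/2) * (G n z + G m z))"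
      unfolding l2_norm_cmult D_def by (simp add: power_mult_distrib)
    moreover have "(l2_norm (\<lambda>z. (F z - G n z) - (F z - G m z)))\<^sup>2 = (l2_norm (\<lambda>z. G m z - G n z))\<^sup>2"
      by simp
    ultimately have "4 * D (\<lambda>z. (1/2) * (G n z + G m z)) + (l2_norm (\<lambda>z. G m z - G n z))\<^sup>2 =
        2 * D (G n) + 2 * D (G m)"
      using l2_parallelogram[OF L2_diff[OF F VL[OF GV[of n]]] L2_diff[OF F VL[OF GV[of m]]]]
      by (simp add: D_def)
    moreover have "(1::real) / 4 ^ m \<le> 1 / 4 ^ n"
      using that by (intro divide_left_mono power_increasing) (use that in auto)
    ultimately show ?thesis
      using dle[OF mid] Gd[of n] Gd[of m] by simp
  qed
  then obtain m where m: "m \<in> L2" "AE z in circle_measure. (\<lambda>n. G n z) \<longlonglongrightarrow> m z"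
    and lim: "\<And>n. (l2_norm (\<lambda>z. G n z - m z))\<^sup>2 \<le> 4 / 4 ^ n"
    using L2_complete[of G 4] VL[OF GV] by blast
  have "(\<lambda>n. (4::real) / 4 ^ n) \<longlonglongrightarrow> 0"
    using tendsto_mult_right_zero[OF LIMSEQ_power_zero[of "1/4::real"], of 4] by (simp add: power_one_over)
  then have "(\<lambda>n. (l2_norm (\<lambda>z. G n z - m z))\<^sup>2) \<longlonglongrightarrow> 0"
    by (rule tendsto_sandwich[OF _ _ tendsto_const, rotated -1]) (auto simp: lim)
  from tendsto_real_sqrt[OF this] have "(\<lambda>n. l2_norm (\<lambda>z. G n z - m z)) \<longlonglongrightarrow> 0"
    by (simp add: l2_norm_nonneg)
  then have mV: "m \<in> V"
    using V GV m(1) unfolding closed_l2_subspace_def by blast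
  have "D m \<le> d + 1 / 4 ^ n" for n
    unfolding D_def
  proof (rule L2_Fatou(2))
    show "(\<lambda>z. F z - G (k + n) z) \<in> L2" for k
      by (rule L2_diff[OF F VL[OF GV]])
    show "AE z in circle_measure. (\<lambda>k. F z - G (k + n) z) \<longlonglongrightarrow> F z - m z"
      using m(2) by eventually_elim (rule tendsto_diff[OF tendsto_const LIMSEQ_ignore_initial_segment])
    have *: "(1::real) / 4 ^ (k + n) \<le> 1 / 4 ^ n" for k
      by (intro divide_left_mono power_increasing) auto
    show "(l2_norm (\<lambda>z. F z - G (k + n) z))\<^sup>2 \<le> d + 1 / 4 ^ n" for k
      using Gd[of "k + n"] *[of k] by (simp add: D_def)
  qed (intro L2_measurable L2_diff F m(1))
  moreover have "(\<lambda>n. d + 1 / 4 ^ n) \<longlonglongrightarrow> d + 0"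
    using LIMSEQ_power_zero[of "1/4::real"] by (intro tendsto_add) (auto simp: power_one_over)
  ultimately have "D m \<le> d"
    using LIMSEQ_le_const[of "\<lambda>n. d + 1 / 4 ^ n" d "D m"] by simp
  then show thesis
    using that[OF mV] dle unfolding D_def by (meson order_trans)
qed

text \<open>
  The error \<open>e\<close> of the nearest point is orthogonal to the subspace: moving from the nearest point
  in the direction \<open>k\<close> by \<open>s * l2_inner e k\<close> with a small \<open>s > 0\<close> would otherwise shorten \<open>e\<close>.
\<close>
theorem closed_l2_subspace_decomposition:
  assumes V: "closed_l2_subspace V" and F: "F \<in> L2"
  obtains m where "m \<in> V" and "(\<lambda>z. F z - m z) \<in> l2_orth V"
proof -
  obtain m where mV: "m \<in> V"
    and min: "\<And>g. g \<in> V \<Longrightarrow> (l2_norm (\<lambda>z. F z - m z))\<^sup>2 \<le> (l2_norm (\<lambda>z. F z - g z))\<^sup>2"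
    using closed_l2_subspace_minimizer[OF V F] by blast
  have VL: "g \<in> L2" if "g \<in> V" for g using V that by (auto simp: closed_l2_subspace_def)
  define e where "e = (\<lambda>z. F z - m z)"
  have e: "e \<in> L2" unfolding e_def by (rule L2_diff[OF F VL[OF mV]])
  have "l2_inner e k = 0" if k: "k \<in> V" for k
  proof -
    define c where "c = l2_inner e k"
    \<comment> \<open>Small enough for the term quadratic in \<open>s\<close> to be dominated by half of the linear one.\<close>
    define s where "s = 1 / (1 + (l2_norm k)\<^sup>2)"
    have s: "0 < s" by (simp add: s_def add_pos_nonneg)
    have "(\<lambda>z. m z + (s * c) * k z) \<in> V"
      by (intro closed_l2_subspace_cmult closed_l2_subspace_add V mV k)
    from min[OF this] have "(l2_norm e)\<^sup>2 \<le> (l2_norm (\<lambda>z. e z - (s * c) * k z))\<^sup>2"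
      by (simp add: e_def algebra_simps)
    also have "\<dots> = (l2_norm e)\<^sup>2 - 2 * Re (l2_inner e (\<lambda>z. (s * c) * k z)) + (l2_norm (\<lambda>z. (s * c) * k z))\<^sup>2"
      by (rule l2_norm_diff_sq[OF e L2_cmult[OF VL[OF k]]])
    also have "l2_inner e (\<lambda>z. (s * c) * k z) = cnj (s * c) * c"
      unfolding c_def by (subst l2_inner_commute) (simp add: l2_inner_cmult_left l2_inner_commute[of k])
    also have "\<dots> = of_real (s * (cmod c)\<^sup>2)"
      using complex_norm_square[of c] by (simp add: ac_simps)
    also have "(l2_norm (\<lambda>z. (s * c) * k z))\<^sup>2 = s * (cmod c)\<^sup>2 * (s * (l2_norm k)\<^sup>2)"
      using s by (simp add: l2_norm_cmult norm_mult power_mult_distrib power2_eq_square)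
    finally have "2 * (s * (cmod c)\<^sup>2) \<le> s * (cmod c)\<^sup>2 * (s * (l2_norm k)\<^sup>2)"
      by simp
    also have "\<dots> \<le> s * (cmod c)\<^sup>2 * 1"
      using s by (intro mult_left_mono) (auto simp: s_def divide_simps add_pos_nonneg)
    finally have "s * (cmod c)\<^sup>2 \<le> 0" by simp
    then show ?thesis
      using s by (simp add: mult_le_0_iff c_def)
  qed
  then show thesis
    using that[OF mV] e by (simp add: l2_orth_def e_def)
qed

section \<open>Projections and the operator\<close>

lemma l2_orth_L2: "f \<in> l2_orth V \<Longrightarrow> f \<in> L2"
  by (simp add: l2_orth_def)

lemma l2_orth_zero: "(\<lambda>z. 0) \<in> l2_orth V"
  by (simp add: l2_orth_def L2_def l2_inner_def)

lemma l2_orth_add: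
  assumes "V \<subseteq> L2" "f \<in> l2_orth V" "g \<in> l2_orth V"
  shows "(\<lambda>z. f z + g z) \<in> l2_orth V"
  using assms by (auto simp: l2_orth_def L2_add l2_inner_add_left subset_iff)

lemma l2_orth_cmult: "f \<in> l2_orth V \<Longrightarrow> (\<lambda>z. c * f z) \<in> l2_orth V"
  by (simp add: l2_orth_def L2_cmult l2_inner_cmult_left)

lemma l2_orth_diff:
  assumes "V \<subseteq> L2" "f \<in> l2_orth V" "g \<in> l2_orth V"
  shows "(\<lambda>z. f z - g z) \<in> l2_orth V"
  using assms by (auto simp: l2_orth_def L2_diff l2_inner_diff_left subset_iff)

lemma l2_orth_subset_L2: "l2_orth V \<subseteq> L2"
  by (auto simp: l2_orth_def)

text \<open>
  The projection is specified by a choice, so both properties need a witness. It is the remainder of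
  the decomposition along \<open>M\<close> itself, whose component in \<open>M\<close> is orthogonal to all of \<open>l2_orth M\<close>.
\<close>
lemma l2_proj_orth:
  assumes M: "closed_l2_subspace M" and F: "F \<in> L2"
  shows "l2_proj (l2_orth M) F \<in> l2_orth M"
    and "(\<lambda>z. F z - l2_proj (l2_orth M) F z) \<in> l2_orth (l2_orth M)"
proof -
  obtain m where m: "m \<in> M" and Fm: "(\<lambda>z. F z - m z) \<in> l2_orth M"
    using closed_l2_subspace_decomposition[OF M F] by blast
  have "m \<in> l2_orth (l2_orth M)"
    using M m by (auto simp: l2_orth_def closed_l2_subspace_def l2_inner_commute[of m])
  then have "\<exists>g. g \<in> l2_orth M \<and> (\<lambda>z. F z - g z) \<in> l2_orth (l2_orth M)"
    using Fm by (intro exI[of _ "\<lambda>z. F z - m z"]) simp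
  then have "l2_proj (l2_orth M) F \<in> l2_orth M \<and>
      (\<lambda>z. F z - l2_proj (l2_orth M) F z) \<in> l2_orth (l2_orth M)"
    unfolding l2_proj_def by (rule someI_ex)
  then show "l2_proj (l2_orth M) F \<in> l2_orth M"
    and "(\<lambda>z. F z - l2_proj (l2_orth M) F z) \<in> l2_orth (l2_orth M)" by auto
qed

text \<open>
  The difference of two candidates lies both in \<open>l2_orth M\<close> and in its orthogonal complement. This is
  how linearity of the operator, whose values are chosen representatives, is obtained.
\<close>
lemma l2_proj_orth_AE_eq:
  assumes M: "closed_l2_subspace M" and F: "F \<in> L2"
    and a: "a \<in> l2_orth M" and Fa: "(\<lambda>z. F z - a z) \<in> l2_orth (l2_orth M)"
  shows "AE z in circle_measure. l2_proj (l2_orth M) F z = a z"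
proof -
  define p where "p = l2_proj (l2_orth M) F"
  have MsubL2: "M \<subseteq> L2" using M by (simp add: closed_l2_subspace_def)
  have p: "p \<in> l2_orth M" "(\<lambda>z. F z - p z) \<in> l2_orth (l2_orth M)"
    unfolding p_def by (rule l2_proj_orth[OF M F])+
  have 1: "(\<lambda>z. p z - a z) \<in> l2_orth M"
    by (rule l2_orth_diff[OF MsubL2 p(1) a])
  have "(\<lambda>z. (F z - a z) - (F z - p z)) \<in> l2_orth (l2_orth M)"
    by (rule l2_orth_diff[OF l2_orth_subset_L2 Fa p(2)])
  then have "l2_inner (\<lambda>z. p z - a z) (\<lambda>z. p z - a z) = 0"
    using 1 by (simp add: l2_orth_def)
  then have "l2_norm (\<lambda>z. p z - a z) = 0"
    by (simp add: l2_inner_self)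
  then have "AE z in circle_measure. p z - a z = 0"
    by (rule l2_norm_eq_0_AE[OF l2_orth_L2[OF 1]])
  then show ?thesis by (simp add: p_def)
qed

lemma l2_proj_orth_contraction:
  assumes M: "closed_l2_subspace M" and F: "F \<in> L2"
  shows "l2_norm (l2_proj (l2_orth M) F) \<le> l2_norm F"
proof -
  define p where "p = l2_proj (l2_orth M) F"
  have p: "p \<in> l2_orth M" "(\<lambda>z. F z - p z) \<in> l2_orth (l2_orth M)"
    unfolding p_def by (rule l2_proj_orth[OF M F])+
  have "l2_inner F p = l2_inner p p"
    using p l2_inner_diff_left[OF F l2_orth_L2[OF p(1)] l2_orth_L2[OF p(1)]]
    by (simp add: l2_orth_def)
  then have "l2_norm p * l2_norm p \<le> l2_norm F * l2_norm p"
    using l2_Cauchy_Schwarz[OF F l2_orth_L2[OF p(1)]]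
    by (simp add: l2_inner_self power2_eq_square norm_mult)
  then have "l2_norm p \<le> l2_norm F"
    using l2_norm_nonneg[of p] l2_norm_nonneg[of F]
    by (cases "l2_norm p = 0") (auto simp: mult_le_cancel_right)
  then show ?thesis by (simp add: p_def)
qed

lemma Linf_measurable: "\<phi> \<in> Linf \<Longrightarrow> \<phi> \<in> borel_measurable circle_measure"
  by (simp add: Linf_def)

text \<open>
  This rules out \<open>-\<infinity>\<close>, at which the conversion to a real number in \<open>linf_norm\<close> returns a default value.
  It holds because the circle is not a null set.
\<close>
lemma esssup_cmod_nonneg: "0 \<le> esssup circle_measure (\<lambda>z. ereal (cmod (\<phi> z)))"
proof -
  have "AE z in circle_measure. ereal (cmod (\<phi> z)) \<le> esssup circle_measure (\<lambda>z. ereal (cmod (\<phi> z)))"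
    by (rule esssup_AE)
  then have "AE z in circle_measure. 0 \<le> esssup circle_measure (\<lambda>z. ereal (cmod (\<phi> z)))"
    by eventually_elim (rule order_trans[rotated], auto)
  then show ?thesis by simp
qed

lemma linf_norm_AE:
  assumes "\<phi> \<in> Linf"
  shows "AE z in circle_measure. cmod (\<phi> z) \<le> linf_norm \<phi>" and "0 \<le> linf_norm \<phi>"
proof -
  define e where "e = esssup circle_measure (\<lambda>z. ereal (cmod (\<phi> z)))"
  have "0 \<le> e" unfolding e_def by (rule esssup_cmod_nonneg)
  moreover have "e < \<infinity>" using assms by (simp add: Linf_def e_def)
  ultimately have e: "e = ereal (linf_norm \<phi>)"
    unfolding linf_norm_def e_def[symmetric] by (cases e) auto
  show "AE z in circle_measure. cmod (\<phi> z) \<le> linf_norm \<phi>"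
    using esssup_AE[of "\<lambda>z. ereal (cmod (\<phi> z))" circle_measure] e by (simp add: e_def)
  show "0 \<le> linf_norm \<phi>"
    using \<open>0 \<le> e\<close> by (simp add: e)
qed

lemma linf_norm_le:
  assumes "\<phi> \<in> borel_measurable circle_measure" and "AE z in circle_measure. cmod (\<phi> z) \<le> C"
  shows "linf_norm \<phi> \<le> C"
proof -
  define e where "e = esssup circle_measure (\<lambda>z. ereal (cmod (\<phi> z)))"
  have "e \<le> ereal C"
    unfolding e_def using assms by (intro esssup_I) auto
  moreover have "0 \<le> e" unfolding e_def by (rule esssup_cmod_nonneg)
  ultimately show ?thesis
    unfolding linf_norm_def e_def[symmetric] by (cases e) auto
qed

lemma L2_Linf_mult:
  assumes "\<phi> \<in> Linf" "f \<in> L2"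
  shows "(\<lambda>z. \<phi> z * f z) \<in> L2" and "l2_norm (\<lambda>z. \<phi> z * f z) \<le> linf_norm \<phi> * l2_norm f"
proof -
  note [measurable] = Linf_measurable[OF assms(1)] L2_measurable[OF assms(2)]
  have le: "AE z in circle_measure. cmod (\<phi> z * f z) \<le> linf_norm \<phi> * cmod (f z)"
    using linf_norm_AE(1)[OF assms(1)]
    by eventually_elim (simp add: norm_mult mult_right_mono)
  show "(\<lambda>z. \<phi> z * f z) \<in> L2"
    by (rule L2_dominated[OF _ assms(2) le]) simp
  show "l2_norm (\<lambda>z. \<phi> z * f z) \<le> linf_norm \<phi> * l2_norm f"
    by (rule l2_norm_mono[OF _ assms(2) le linf_norm_AE(2)[OF assms(1)]]) simp
qed

lemma dual_trunc_toeplitz_norm_le: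
  assumes "closed_l2_subspace M" "\<phi> \<in> Linf" "f \<in> L2"
  shows "l2_norm (dual_trunc_toeplitz M \<phi> f) \<le> linf_norm \<phi> * l2_norm f"
  unfolding dual_trunc_toeplitz_def
  using l2_proj_orth_contraction[OF assms(1) L2_Linf_mult(1)[OF assms(2,3)]] L2_Linf_mult(2)[OF assms(2,3)]
  by linarith

lemma bounded_dual_trunc_toeplitz:
  assumes M: "closed_l2_subspace M" and \<phi>: "\<phi> \<in> Linf"
  shows "bounded_l2_operator (l2_orth M) (dual_trunc_toeplitz M \<phi>)"
  unfolding bounded_l2_operator_def
proof (intro conjI ballI allI)
  note prod = L2_Linf_mult(1)[OF \<phi> l2_orth_L2]
  note D = l2_proj_orth[OF M prod]
  fix f assume f: "f \<in> l2_orth M"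
  show "dual_trunc_toeplitz M \<phi> f \<in> l2_orth M"
    unfolding dual_trunc_toeplitz_def by (rule D(1)[OF f])
  fix c
  show "AE z in circle_measure. dual_trunc_toeplitz M \<phi> (\<lambda>z. c * f z) z = c * dual_trunc_toeplitz M \<phi> f z"
    unfolding dual_trunc_toeplitz_def
  proof (rule l2_proj_orth_AE_eq[OF M prod[OF l2_orth_cmult[OF f]]])
    show "(\<lambda>z. c * l2_proj (l2_orth M) (\<lambda>z. \<phi> z * f z) z) \<in> l2_orth M"
      by (rule l2_orth_cmult[OF D(1)[OF f]])
    show "(\<lambda>z. \<phi> z * (c * f z) - c * l2_proj (l2_orth M) (\<lambda>z. \<phi> z * f z) z) \<in> l2_orth (l2_orth M)"
      using l2_orth_cmult[OF D(2)[OF f], of c] by (simp add: algebra_simps)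
  qed
next
  have MsubL2: "M \<subseteq> L2" using M by (simp add: closed_l2_subspace_def)
  note prod = L2_Linf_mult(1)[OF \<phi> l2_orth_L2]
  note D = l2_proj_orth[OF M prod]
  fix f g assume f: "f \<in> l2_orth M" and g: "g \<in> l2_orth M"
  show "AE z in circle_measure. dual_trunc_toeplitz M \<phi> (\<lambda>z. f z + g z) z =
      dual_trunc_toeplitz M \<phi> f z + dual_trunc_toeplitz M \<phi> g z"
    unfolding dual_trunc_toeplitz_def
  proof (rule l2_proj_orth_AE_eq[OF M prod[OF l2_orth_add[OF MsubL2 f g]]])
    show "(\<lambda>z. l2_proj (l2_orth M) (\<lambda>z. \<phi> z * f z) z + l2_proj (l2_orth M) (\<lambda>z. \<phi> z * g z) z)
        \<in> l2_orth M"
      by (rule l2_orth_add[OF MsubL2 D(1)[OF f] D(1)[OF g]])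
    show "(\<lambda>z. \<phi> z * (f z + g z) - (l2_proj (l2_orth M) (\<lambda>z. \<phi> z * f z) z +
        l2_proj (l2_orth M) (\<lambda>z. \<phi> z * g z) z)) \<in> l2_orth (l2_orth M)"
      using l2_orth_add[OF l2_orth_subset_L2 D(2)[OF f] D(2)[OF g]] by (simp add: algebra_simps)
  qed
next
  show "\<exists>C. \<forall>f\<in>l2_orth M. l2_norm (dual_trunc_toeplitz M \<phi> f) \<le> C * l2_norm f"
    using dual_trunc_toeplitz_norm_le[OF M \<phi> l2_orth_L2] by blast
qed

lemma l2_operator_norm_le:
  assumes "\<And>f. f \<in> V \<Longrightarrow> l2_norm (A f) \<le> B * l2_norm f" "0 \<le> B" "(\<lambda>z. 0) \<in> V"
  shows "l2_operator_norm V A \<le> B"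
  unfolding l2_operator_norm_def
proof (rule cSUP_least)
  show "{f \<in> V. l2_norm f \<le> 1} \<noteq> {}"
    using assms(3) by (auto simp: l2_norm_def intro!: exI[of _ "\<lambda>z. 0"])
  fix f assume "f \<in> {f \<in> V. l2_norm f \<le> 1}"
  then have f: "f \<in> V" "l2_norm f \<le> 1" by auto
  have "l2_norm (A f) \<le> B * l2_norm f" by (rule assms(1)[OF f(1)])
  also have "\<dots> \<le> B * 1" using f(2) assms(2) by (rule mult_left_mono)
  finally show "l2_norm (A f) \<le> B" by simp
qed

text \<open>
  For \<open>f\<close> in \<open>l2_orth M\<close> the projection drops out of \<open>l2_inner (dual_trunc_toeplitz M \<phi> f) f\<close>, so the
  operator norm controls the quadratic form of multiplication by \<open>\<phi>\<close>. This form depends on \<open>f\<close> only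
  through its modulus, which is what the lower bound for the norm exploits.
\<close>
lemma dual_trunc_toeplitz_quadratic_form:
  assumes M: "closed_l2_subspace M" and \<phi>: "\<phi> \<in> Linf" and f: "f \<in> l2_orth M"
  shows "cmod (LINT z|circle_measure. \<phi> z * of_real ((cmod (f z))\<^sup>2))
    \<le> l2_operator_norm (l2_orth M) (dual_trunc_toeplitz M \<phi>) * (LINT z|circle_measure. (cmod (f z))\<^sup>2)"
proof -
  let ?D = "dual_trunc_toeplitz M \<phi>" and ?C = "l2_operator_norm (l2_orth M) (dual_trunc_toeplitz M \<phi>)"
  have unit: "cmod (LINT z|circle_measure. \<phi> z * of_real ((cmod (g z))\<^sup>2)) \<le> ?C"
    if g: "g \<in> l2_orth M" and g1: "l2_norm g = 1" for g
  proof -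
    note gL = l2_orth_L2[OF g]
    note pg = L2_Linf_mult(1)[OF \<phi> gL]
    have D: "?D g \<in> l2_orth M" "(\<lambda>z. \<phi> z * g z - ?D g z) \<in> l2_orth (l2_orth M)"
      unfolding dual_trunc_toeplitz_def by (rule l2_proj_orth[OF M pg])+
    have "(LINT z|circle_measure. \<phi> z * of_real ((cmod (g z))\<^sup>2)) = l2_inner (\<lambda>z. \<phi> z * g z) g"
      by (simp add: l2_inner_def complex_norm_square mult.assoc del: of_real_power)
    also have "\<dots> = l2_inner (?D g) g"
      using D(2) g l2_inner_diff_left[OF pg l2_orth_L2[OF D(1)] gL] by (simp add: l2_orth_def)
    also have "cmod \<dots> \<le> l2_norm (?D g) * l2_norm g"
      by (rule l2_Cauchy_Schwarz[OF l2_orth_L2[OF D(1)] gL])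
    also have "\<dots> \<le> ?C"
      unfolding l2_operator_norm_def g1 mult_1_right
    proof (rule cSUP_upper)
      show "bdd_above ((\<lambda>f. l2_norm (?D f)) ` {f \<in> l2_orth M. l2_norm f \<le> 1})"
      proof (rule bdd_aboveI2[where M = "linf_norm \<phi>"])
        fix k assume "k \<in> {f \<in> l2_orth M. l2_norm f \<le> 1}"
        then have k: "k \<in> l2_orth M" "l2_norm k \<le> 1" by auto
        have "l2_norm (?D k) \<le> linf_norm \<phi> * l2_norm k"
          by (rule dual_trunc_toeplitz_norm_le[OF M \<phi> l2_orth_L2[OF k(1)]])
        also have "\<dots> \<le> linf_norm \<phi> * 1"
          by (rule mult_left_mono[OF k(2) linf_norm_AE(2)[OF \<phi>]])
        finally show "l2_norm (?D k) \<le> linf_norm \<phi>" by simp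
      qed
    qed (use g g1 in auto)
    finally show ?thesis by simp
  qed
  show ?thesis
  proof (cases "l2_norm f = 0")
    case True
    then have "AE z in circle_measure. \<phi> z * of_real ((cmod (f z))\<^sup>2) = 0"
      using l2_norm_eq_0_AE[OF l2_orth_L2[OF f]] by auto
    then have "(LINT z|circle_measure. \<phi> z * of_real ((cmod (f z))\<^sup>2)) = 0"
      by (rule integral_eq_zero_AE)
    then show ?thesis using True by (simp flip: l2_norm_sq)
  next
    case False
    define t where "t = 1 / l2_norm f"
    have t: "0 < t" using False l2_norm_nonneg[of f] by (simp add: t_def)
    have "l2_norm (\<lambda>z. of_real t * f z) = 1"
      using False unfolding l2_norm_cmult norm_of_real abs_of_pos[OF t] by (simp add: t_def)
    from unit[OF l2_orth_cmult[OF f] this]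
    have "cmod (LINT z|circle_measure. of_real (t\<^sup>2) * (\<phi> z * of_real ((cmod (f z))\<^sup>2))) \<le> ?C"
      using t by (simp add: norm_mult power_mult_distrib ac_simps)
    then have "t\<^sup>2 * cmod (LINT z|circle_measure. \<phi> z * of_real ((cmod (f z))\<^sup>2)) \<le> ?C"
      by (simp add: norm_mult norm_power)
    then show ?thesis
      using False by (simp add: t_def power_divide divide_le_eq flip: l2_norm_sq)
  qed
qed

section \<open>Moduli of functions orthogonal to the Hardy space\<close>

lemma continuous_L2:
  assumes cont: "continuous_on UNIV f"
  shows "f \<in> L2"
proof -
  have "bounded (f ` sphere 0 1)"
    by (intro compact_imp_bounded compact_continuous_image continuous_on_subset[OF cont]) auto
  then obtain B where B: "\<forall>z\<in>sphere 0 1. cmod (f z) \<le> B"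
    by (auto simp: bounded_iff)
  show ?thesis
  proof (rule L2_bounded)
    show "f \<in> borel_measurable circle_measure"
      by (intro borel_measurable_circle borel_measurable_continuous_onI cont)
    show "AE z in circle_measure. cmod (f z) \<le> B"
      by (intro AE_I2) (use B in simp)
  qed
qed

text \<open>
  On the circle, multiplication by \<open>cnj z ^ Suc (degree p)\<close> is multiplication by a negative power of \<open>z\<close>.
  It moves all frequencies of the polynomial below 0 without changing its modulus.
\<close>
lemma conj_power_poly_orth_H2:
  "(\<lambda>z. cnj z ^ Suc (degree p) * poly p z) \<in> l2_orth H2"
proof -
  define d where "d = Suc (degree p)"
  define e where "e k z = z ^ k * cnj z ^ d" for k and z :: complex
  have e: "e k \<in> L2" for k
    by (rule continuous_L2) (auto simp: e_def[abs_def] intro!: continuous_intros)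
  have f: "(\<lambda>z. cnj z ^ d * poly p z) = (\<lambda>z. \<Sum>k\<le>degree p. coeff p k * e k z)"
    by (rule ext) (simp add: poly_altdef e_def sum_distrib_left ac_simps)
  have "l2_inner (\<lambda>z. cnj z ^ d * poly p z) q = 0" if q: "q \<in> H2" for q
  proof -
    have qL: "q \<in> L2" using q by (simp add: H2_def)
    have inner_e: "l2_inner (e k) q = 0" if k: "k \<le> degree p" for k
    proof -
      have "e k z * cnj (q z) = cnj (q z * cnj (z powi (int k - int d)))"
        if z: "cmod z = 1" for z
      proof -
        have "z \<noteq> 0" using z by auto
        moreover have "cnj z = 1 / z"
          using complex_norm_square[of z] z \<open>z \<noteq> 0\<close> by (simp add: field_simps)
        ultimately show ?thesis
          by (simp add: e_def power_int_diff power_inverse divide_inverse)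
      qed
      then have "l2_inner (e k) q =
          (LINT z|circle_measure. cnj (q z * cnj (z powi (int k - int d))))"
        unfolding l2_inner_def by (intro Bochner_Integration.integral_cong) auto
      also have "\<dots> = cnj (fourier_coeff q (int k - int d))"
        unfolding fourier_coeff_def by (rule Bochner_Integration.integral_cnj)
      also have "fourier_coeff q (int k - int d) = 0"
        using q k by (simp add: H2_def d_def)
      finally show ?thesis by simp
    qed
    have "l2_inner (\<lambda>z. cnj z ^ d * poly p z) q =
        (LINT z|circle_measure. (\<Sum>k\<le>degree p. coeff p k * (e k z * cnj (q z))))"
      unfolding f l2_inner_def by (simp add: sum_distrib_right mult.assoc)
    also have "\<dots> = (\<Sum>k\<le>degree p. coeff p k * l2_inner (e k) q)"
      by (subst Bochner_Integration.integral_sum)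
        (auto simp: l2_inner_def intro!: integrable_mult_right L2_integrable_mult e qL)
    also have "\<dots> = 0" using inner_e by simp
    finally show ?thesis .
  qed
  moreover have "(\<lambda>z. cnj z ^ d * poly p z) \<in> L2"
    by (rule continuous_L2) (auto intro!: continuous_intros)
  ultimately show ?thesis by (simp add: l2_orth_def d_def)
qed

text \<open>
  On the circle \<open>cnj z = 1 / z\<close>, so the real and imaginary parts of \<open>z\<close> become quadratic polynomials after
  multiplication by \<open>z\<close>. Every real polynomial in two variables is therefore, on the circle, a complex
  polynomial up to a power of \<open>z\<close>, hence up to a unimodular factor.
\<close>
lemma real_polynomial_on_circle:
  fixes g :: "complex \<Rightarrow> real"
  assumes "real_polynomial_function g"
  shows "\<exists>N p. \<forall>z. cmod z = 1 \<longrightarrow> z ^ N * of_real (g z) = poly p z"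
  using assms
proof induction
  case (linear g)
  \<comment> \<open>The coefficients come from \<open>2 * Re z = z + 1 / z\<close> and \<open>2 * Im z = - \<i> * (z - 1 / z)\<close>.\<close>
  define q where "q = [:(of_real (g 1) + \<i> * of_real (g \<i>)) / 2, 0, (of_real (g 1) - \<i> * of_real (g \<i>)) / 2:]"
  have "z ^ 1 * of_real (g z) = poly q z" if z: "cmod z = 1" for z
  proof -
    interpret g: bounded_linear g by fact
    have "g z = g (Re z *\<^sub>R 1 + Im z *\<^sub>R \<i>)"
      by (rule arg_cong[where f = g]) (simp add: complex_eq_iff)
    then have gz: "g z = Re z * g 1 + Im z * g \<i>"
      by (simp only: g.add g.scaleR real_scaleR_def)
    have zz: "z * cnj z = 1" using complex_norm_square[of z] z by simp
    have ReIm: "complex_of_real (Re z) = (z + cnj z) / 2" "complex_of_real (Im z) = - \<i> * (z - cnj z) / 2"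
      by (simp_all add: complex_eq_iff Re_divide Im_divide)
    have "z * of_real (g z) = (z * z + z * cnj z) / 2 * of_real (g 1) +
        (- \<i> * (z * z - z * cnj z) / 2) * of_real (g \<i>)"
      unfolding gz of_real_add of_real_mult ReIm by (simp add: field_simps)
    then show ?thesis
      unfolding zz by (simp add: q_def field_simps)
  qed
  then show ?case by blast
next
  case (const c)
  show ?case by (rule exI[of _ 0], rule exI[of _ "[:of_real c:]"]) simp
next
  case (add f g)
  then obtain N p K q where p: "\<And>z. cmod z = 1 \<Longrightarrow> z ^ N * of_real (f z) = poly p z"
    and q: "\<And>z. cmod z = 1 \<Longrightarrow> z ^ K * of_real (g z) = poly q z" by blast
  have "z ^ (N + K) * of_real (f z + g z) = poly (monom 1 K * p + monom 1 N * q) z" if "cmod z = 1" for z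
    unfolding poly_add poly_mult poly_monom p[OF that, symmetric] q[OF that, symmetric]
    by (simp add: power_add algebra_simps)
  then show ?case by blast
next
  case (mult f g)
  then obtain N p K q where p: "\<And>z. cmod z = 1 \<Longrightarrow> z ^ N * of_real (f z) = poly p z"
    and q: "\<And>z. cmod z = 1 \<Longrightarrow> z ^ K * of_real (g z) = poly q z" by blast
  have "z ^ (N + K) * of_real (f z * g z) = poly (p * q) z" if "cmod z = 1" for z
    unfolding poly_mult p[OF that, symmetric] q[OF that, symmetric]
    by (simp add: power_add algebra_simps)
  then show ?case by blast
qed

lemma poly_modulus_approx:
  fixes w :: "complex \<Rightarrow> real"
  assumes "continuous_on (sphere 0 1) w" and "0 < e"
  obtains p :: "complex poly" where "\<And>z. cmod z = 1 \<Longrightarrow> \<bar>cmod (poly p z) - \<bar>w z\<bar>\<bar> < e"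
proof -
  obtain g where g: "real_polynomial_function g" "\<And>z. z \<in> sphere 0 1 \<Longrightarrow> \<bar>w z - g z\<bar> < e"
    using Stone_Weierstrass_real_polynomial_function[OF compact_sphere assms] by blast
  obtain N p where p: "\<And>z. cmod z = 1 \<Longrightarrow> z ^ N * of_real (g z) = poly p z"
    using real_polynomial_on_circle[OF g(1)] by blast
  have "\<bar>cmod (poly p z) - \<bar>w z\<bar>\<bar> < e" if z: "cmod z = 1" for z
    unfolding p[OF z, symmetric] using g(2)[of z] z by (simp add: norm_mult norm_power)
  then show thesis by (rule that)
qed

text \<open>
  The indicator of a compact set is the pointwise limit of the continuous functions
  \<open>max 0 (1 - n * infdist z K)\<close>, and each of these is nearly the modulus of a polynomial.
\<close>
lemma poly_modulus_indicator:
  assumes K: "compact K"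
  obtains p :: "nat \<Rightarrow> complex poly"
  where "\<And>n z. cmod z = 1 \<Longrightarrow> cmod (poly (p n) z) \<le> 2"
    and "\<And>z. cmod z = 1 \<Longrightarrow> (\<lambda>n. cmod (poly (p n) z)) \<longlonglongrightarrow> indicator K z"
proof (cases "K = {}")
  \<comment> \<open>Here \<open>infdist\<close> takes its default value 0, so the approximating functions would be constantly 1.\<close>
  case True
  show thesis by (rule that[of "\<lambda>_. 0"]) (auto simp: True)
next
  case False
  define w where "w n z = max 0 (1 - real n * infdist z K)" for n z
  have "\<exists>p :: complex poly. \<forall>z. cmod z = 1 \<longrightarrow> \<bar>cmod (poly p z) - \<bar>w n z\<bar>\<bar> < inverse (real (Suc n))" for n
  proof -
    have "continuous_on (sphere 0 1) (w n)"
      unfolding w_def by (intro continuous_intros)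
    then obtain p :: "complex poly"
      where "\<And>z. cmod z = 1 \<Longrightarrow> \<bar>cmod (poly p z) - \<bar>w n z\<bar>\<bar> < inverse (real (Suc n))"
      using poly_modulus_approx[of "w n" "inverse (real (Suc n))"] by auto
    then show ?thesis by blast
  qed
  then obtain p :: "nat \<Rightarrow> complex poly"
    where p: "\<And>n z. cmod z = 1 \<Longrightarrow> \<bar>cmod (poly (p n) z) - \<bar>w n z\<bar>\<bar> < inverse (real (Suc n))"
    by metis
  show thesis
  proof (rule that[of p])
    fix z :: complex assume z: "cmod z = 1"
    have "0 \<le> w n z" "w n z \<le> 1" for n
      by (auto simp: w_def infdist_nonneg)
    then have w: "\<bar>w n z\<bar> = w n z" "w n z \<le> 1" for n by auto
    have "inverse (real (Suc n)) \<le> 1" for n by (simp add: field_simps)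
    then show "cmod (poly (p n) z) \<le> 2" for n
      using p[OF z, of n] w[of n] by (smt (verit))
    have lim_w: "(\<lambda>n. w n z) \<longlonglongrightarrow> indicator K z"
    proof (cases "z \<in> K")
      case True
      then show ?thesis by (simp add: w_def)
    next
      case zK: False
      then have pos: "0 < infdist z K"
        using K False in_closed_iff_infdist_zero[of K z] infdist_nonneg[of z K]
        by (auto simp: compact_imp_closed less_le)
      obtain N where "1 / infdist z K < real N" using reals_Archimedean2 by blast
      then have N: "1 < real N * infdist z K" using pos by (simp add: field_simps)
      have "w n z = 0" if "N \<le> n" for n
      proof -
        have "real N * infdist z K \<le> real n * infdist z K"
          using that pos by (intro mult_right_mono) auto
        then show ?thesis using N by (simp add: w_def)
      qed
      then have "\<forall>\<^sub>F n in sequentially. w n z = indicator K z"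
        using zK by (auto simp: eventually_sequentially)
      then show ?thesis by (rule tendsto_eventually)
    qed
    have "(\<lambda>n. cmod (poly (p n) z) - w n z) \<longlonglongrightarrow> 0"
    proof (rule Lim_null_comparison[OF _ LIMSEQ_inverse_real_of_nat])
      show "\<forall>\<^sub>F n in sequentially. norm (cmod (poly (p n) z) - w n z) \<le> inverse (real (Suc n))"
        using p[OF z] unfolding w(1) by (intro always_eventually allI) (simp add: less_imp_le)
    qed
    from tendsto_add[OF this lim_w]
    show "(\<lambda>n. cmod (poly (p n) z)) \<longlonglongrightarrow> indicator K z" by simp
  qed
qed

section \<open>The lower bound for the norm\<close>

text \<open>
  Dominated convergence along polynomials whose moduli tend to the indicator of \<open>K\<close>. The squares are
  harmless because an indicator is its own square.
\<close>
lemma compact_integral_bound: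
  assumes \<phi>: "\<phi> \<in> Linf"
    and quad: "\<And>p. cmod (LINT z|circle_measure. \<phi> z * of_real ((cmod (poly p z))\<^sup>2))
        \<le> C * (LINT z|circle_measure. (cmod (poly p z))\<^sup>2)"
    and K: "compact K" "K \<subseteq> sphere 0 1"
  shows "cmod (LINT z|circle_measure. \<phi> z * indicator K z) \<le> C * measure circle_measure K"
proof -
  note [measurable] = Linf_measurable[OF \<phi>]
  have Ks [measurable]: "K \<in> sets circle_measure"
    using K by (simp add: sets_circle_measure sets_restrict_space_iff compact_imp_closed)
  obtain p :: "nat \<Rightarrow> complex poly"
    where bd: "\<And>n z. cmod z = 1 \<Longrightarrow> cmod (poly (p n) z) \<le> 2"
      and lim: "\<And>z. cmod z = 1 \<Longrightarrow> (\<lambda>n. cmod (poly (p n) z)) \<longlonglongrightarrow> indicator K z"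
    using poly_modulus_indicator[OF K(1)] by blast
  have [measurable]: "poly (p n) \<in> borel_measurable circle_measure" for n
    by (intro borel_measurable_circle borel_measurable_continuous_onI continuous_intros)
  have lim2: "(\<lambda>n. (cmod (poly (p n) z))\<^sup>2) \<longlonglongrightarrow> indicator K z" if "cmod z = 1" for z
    using tendsto_power[OF lim[OF that], of 2] by (cases "z \<in> K") simp_all
  have bd2: "(cmod (poly (p n) z))\<^sup>2 \<le> 4" if "cmod z = 1" for n z
    using power_mono[OF bd[OF that, of n], of 2] by simp
  have "(\<lambda>n. LINT z|circle_measure. (cmod (poly (p n) z))\<^sup>2) \<longlonglongrightarrow> (LINT z|circle_measure. indicator K z)"
    by (rule integral_dominated_convergence[where w = "\<lambda>_. 4"]) (auto intro!: AE_I2 lim2 bd2)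
  then have r: "(\<lambda>n. C * (LINT z|circle_measure. (cmod (poly (p n) z))\<^sup>2)) \<longlonglongrightarrow> C * measure circle_measure K"
    using K(2) by (intro tendsto_mult_left) (simp add: Int_absorb2)
  have "(\<lambda>n. LINT z|circle_measure. \<phi> z * of_real ((cmod (poly (p n) z))\<^sup>2))
      \<longlonglongrightarrow> (LINT z|circle_measure. \<phi> z * of_real (indicator K z))"
  proof (rule integral_dominated_convergence[where w = "\<lambda>_. linf_norm \<phi> * 4"])
    show "AE z in circle_measure. (\<lambda>n. \<phi> z * of_real ((cmod (poly (p n) z))\<^sup>2))
        \<longlonglongrightarrow> \<phi> z * of_real (indicator K z)"
      by (intro AE_I2 tendsto_mult_left tendsto_of_real lim2) simp
    show "AE z in circle_measure. cmod (\<phi> z * of_real ((cmod (poly (p n) z))\<^sup>2)) \<le> linf_norm \<phi> * 4" for n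
      using linf_norm_AE(1)[OF \<phi>] AE_circle_cmod
    proof eventually_elim
      case (elim z)
      then show ?case
        using mult_mono[OF elim(1) bd2[OF elim(2), of n]] linf_norm_AE(2)[OF \<phi>] by (simp add: norm_mult norm_power)
    qed
  qed simp_all
  from LIMSEQ_le[OF tendsto_norm[OF this] r] quad
  have "cmod (LINT z|circle_measure. \<phi> z * of_real (indicator K z)) \<le> C * measure circle_measure K"
    by blast
  moreover have "complex_of_real (indicator K z) = indicator K z" for z
    by (simp add: indicator_def)
  ultimately show ?thesis by simp
qed

text \<open>
  Inner regularity is a fact about Borel measures on a Polish space, so the measure is pushed
  forward from the circle to the whole plane.
\<close>
lemma circle_inner_regular:
  assumes A: "A \<in> sets circle_measure" and e: "0 < e"
  obtains K where "compact K" "K \<subseteq> A" "measure circle_measure (A - K) < e"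
proof -
  have Ab: "A \<in> sets borel" and As: "A \<subseteq> sphere 0 1"
    using A by (auto simp: sets_circle_measure sets_restrict_space_iff)
  have id: "(\<lambda>z. z) \<in> measurable circle_measure borel"
    by (intro borel_measurable_circle) simp
  define N where "N = distr circle_measure borel (\<lambda>z. z)"
  have N: "emeasure N B = emeasure circle_measure B" if "B \<in> sets borel" "B \<subseteq> sphere 0 1" for B
    unfolding N_def using that by (subst emeasure_distr[OF id]) (auto simp: Int_absorb2)
  interpret N: prob_space N
    unfolding N_def by (rule circle.prob_space_distr[OF id])
  have "emeasure N A = (SUP K \<in> {K. K \<subseteq> A \<and> compact K}. emeasure N K)"
  proof (rule inner_regular)
    show "emeasure N (space N) \<noteq> \<infinity>" using N.emeasure_space_1 by simp
  qed (simp_all add: N_def Ab)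
  moreover have "{K. K \<subseteq> A \<and> compact K} \<noteq> {}" using compact_empty by blast
  moreover have "emeasure N A \<noteq> \<infinity>" using N.emeasure_finite by simp
  ultimately have "\<exists>K\<in>{K. K \<subseteq> A \<and> compact K}. emeasure N A < emeasure N K + ennreal e"
    by (intro SUP_approx_ennreal[OF e])
  then obtain K where K: "K \<subseteq> A" "compact K" "emeasure N A < emeasure N K + ennreal e"
    by blast
  have Ks: "K \<in> sets borel" using K(2) by (simp add: compact_imp_closed)
  have "ennreal (measure circle_measure A) < ennreal (measure circle_measure K + e)"
    using K(3) N[OF Ab As] N[OF Ks] K(1) As e by (simp add: circle.emeasure_eq_measure)
  then have "measure circle_measure A < measure circle_measure K + e"
    using e by (simp add: ennreal_less_iff del: ennreal_plus)
  moreover have "measure circle_measure (A - K) = measure circle_measure A - measure circle_measure K"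
    using A K(1) As Ks
    by (intro circle.finite_measure_Diff) (auto simp: sets_circle_measure sets_restrict_space_iff)
  ultimately show thesis
    using that[OF K(2,1)] by simp
qed

text \<open>
  The bound for the quadratic forms passes to averages of \<open>\<phi>\<close> over compact sets, and by inner
  regularity to averages over all measurable sets, since \<open>\<phi>\<close> is bounded. If all averages of a function
  lie in a closed set, here a disk of radius \<open>C\<close>, then so do almost all of its values.
\<close>
lemma AE_bound_from_quadratic_forms:
  assumes \<phi>: "\<phi> \<in> Linf"
    and quad: "\<And>p. cmod (LINT z|circle_measure. \<phi> z * of_real ((cmod (poly p z))\<^sup>2))
        \<le> C * (LINT z|circle_measure. (cmod (poly p z))\<^sup>2)"
  shows "AE z in circle_measure. cmod (\<phi> z) \<le> C"
proof -
  note [measurable] = Linf_measurable[OF \<phi>]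
  have "0 \<le> C"
    using quad[of 1] by (simp add: circle.prob_space[simplified]) (meson norm_ge_zero order_trans)
  have bdd: "AE z in circle_measure. cmod (\<phi> z) \<le> linf_norm \<phi>" and B: "0 \<le> linf_norm \<phi>"
    by (rule linf_norm_AE[OF \<phi>])+
  have int: "integrable circle_measure \<phi>"
    by (rule circle.integrable_const_bound[OF bdd]) simp
  have avg: "cmod (LINT z|circle_measure. \<phi> z * indicator A z) \<le> C * measure circle_measure A"
    if A [measurable]: "A \<in> sets circle_measure" for A
  proof (rule field_le_epsilon)
    fix e :: real assume e: "0 < e"
    define r where "r = e / (linf_norm \<phi> + 1)"
    have r: "0 < r" using e B by (simp add: r_def)
    obtain K where K: "compact K" "K \<subseteq> A" "measure circle_measure (A - K) < r"
      by (rule circle_inner_regular[OF A r])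
    have Ks: "K \<subseteq> sphere 0 1" using K(2) sets.sets_into_space[OF A] by simp
    have [measurable]: "K \<in> sets circle_measure"
      using K(1) Ks by (simp add: sets_circle_measure sets_restrict_space_iff compact_imp_closed)
    have i: "integrable circle_measure (\<lambda>z. \<phi> z * indicator S z)" if "S \<in> sets circle_measure" for S
      by (rule Bochner_Integration.integrable_bound[OF int]) (use that in \<open>auto simp: indicator_def\<close>)
    have "(LINT z|circle_measure. \<phi> z * indicator A z) =
        (LINT z|circle_measure. \<phi> z * indicator K z + \<phi> z * indicator (A - K) z)"
      using K(2) by (intro Bochner_Integration.integral_cong) (auto simp: indicator_def)
    also have "\<dots> = (LINT z|circle_measure. \<phi> z * indicator K z) + (LINT z|circle_measure. \<phi> z * indicator (A - K) z)"
      by (intro Bochner_Integration.integral_add i) auto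
    also have "cmod \<dots> \<le> C * measure circle_measure K + linf_norm \<phi> * r"
    proof (rule norm_triangle_mono)
      show "cmod (LINT z|circle_measure. \<phi> z * indicator K z) \<le> C * measure circle_measure K"
        by (rule compact_integral_bound[OF \<phi> quad K(1) Ks])
      have "cmod (LINT z|circle_measure. \<phi> z * indicator (A - K) z) \<le>
          (LINT z|circle_measure. cmod (\<phi> z * indicator (A - K) z))"
        by (rule integral_norm_bound)
      also have "\<dots> \<le> (LINT z|circle_measure. linf_norm \<phi> * indicator (A - K) z)"
      proof (rule integral_mono_AE)
        show "AE z in circle_measure. cmod (\<phi> z * indicator (A - K) z) \<le> linf_norm \<phi> * indicator (A - K) z"
          using bdd by eventually_elim (simp add: indicator_def)
        show "integrable circle_measure (\<lambda>z. linf_norm \<phi> * indicator (A - K) z)"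
          by (intro integrable_mult_right circle.integrable_const_bound[where B = 1])
            (auto simp: indicator_def)
      qed (intro integrable_norm i, auto)
      also have "\<dots> = linf_norm \<phi> * measure circle_measure (A - K)"
        using sets.sets_into_space[OF A] by (simp add: Int_absorb2 Diff_subset_conv le_supI2)
      also have "\<dots> \<le> linf_norm \<phi> * r"
        using K(3) B by (intro mult_left_mono) auto
      finally show "cmod (LINT z|circle_measure. \<phi> z * indicator (A - K) z) \<le> linf_norm \<phi> * r" .
    qed
    also have "\<dots> \<le> C * measure circle_measure A + e"
    proof (rule add_mono)
      show "C * measure circle_measure K \<le> C * measure circle_measure A"
        using K(2) \<open>0 \<le> C\<close> by (intro mult_left_mono circle.finite_measure_mono) auto
      show "linf_norm \<phi> * r \<le> e"
        using e B by (simp add: r_def field_simps)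
    qed
    finally show "cmod (LINT z|circle_measure. \<phi> z * indicator A z) \<le> C * measure circle_measure A + e" .
  qed
  have "AE z in circle_measure. \<phi> z \<in> cball 0 C"
  proof (rule circle.averaging_theorem[OF int closed_cball])
    fix A assume A: "A \<in> sets circle_measure" "0 < measure circle_measure A"
    have "set_lebesgue_integral circle_measure A \<phi> = (LINT z|circle_measure. \<phi> z * indicator A z)"
      unfolding set_lebesgue_integral_def
      by (intro Bochner_Integration.integral_cong) (auto simp: indicator_def)
    then show "(1 / measure circle_measure A) *\<^sub>R set_lebesgue_integral circle_measure A \<phi> \<in> cball 0 C"
      using avg[OF A(1)] A(2) by (simp add: divide_le_eq)
  qed
  then show ?thesis by simp
qed

theorem theorem3p4:
  fixes M :: "(complex \<Rightarrow> complex) set" and u h \<phi> :: "complex \<Rightarrow> complex"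
  assumes "closed_l2_subspace M"
    and "M \<subset> H2"
    and "\<exists>f\<in>M. \<not> (AE z in circle_measure. f z = 0)"
    and "nearly_invariant M"
    and "inner_function u"
    and "\<not> (\<exists>c. AE z in circle_measure. u z = c)"
    and "disk_ext u 0 = 0"
    and "extremal_function M h"
    and "M = mult_image h (model_space u)"
    and "\<forall>k\<in>model_space u. l2_norm (\<lambda>z. h z * k z) = l2_norm k"
    and "\<phi> \<in> Linf"
  shows "bounded_l2_operator (l2_orth M) (dual_trunc_toeplitz M \<phi>) \<and>
         l2_operator_norm (l2_orth M) (dual_trunc_toeplitz M \<phi>) = linf_norm \<phi>"
proof
  note M = \<open>closed_l2_subspace M\<close> and \<phi> = \<open>\<phi> \<in> Linf\<close>
  let ?C = "l2_operator_norm (l2_orth M) (dual_trunc_toeplitz M \<phi>)"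
  show "bounded_l2_operator (l2_orth M) (dual_trunc_toeplitz M \<phi>)"
    by (rule bounded_dual_trunc_toeplitz[OF M \<phi>])
  have "cmod (LINT z|circle_measure. \<phi> z * of_real ((cmod (poly p z))\<^sup>2))
      \<le> ?C * (LINT z|circle_measure. (cmod (poly p z))\<^sup>2)" for p
  proof -
    define f where "f z = cnj z ^ Suc (degree p) * poly p z" for z
    have "f \<in> l2_orth M"
      using conj_power_poly_orth_H2[of p] \<open>M \<subset> H2\<close> unfolding f_def l2_orth_def by blast
    note dual_trunc_toeplitz_quadratic_form[OF M \<phi> this]
    moreover have "cmod (f z) = cmod (poly p z)" if "cmod z = 1" for z
      using that by (simp add: f_def norm_mult norm_power)
    then have "(LINT z|circle_measure. \<phi> z * of_real ((cmod (f z))\<^sup>2)) =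
        (LINT z|circle_measure. \<phi> z * of_real ((cmod (poly p z))\<^sup>2))"
      and "(LINT z|circle_measure. (cmod (f z))\<^sup>2) = (LINT z|circle_measure. (cmod (poly p z))\<^sup>2)"
      by (intro Bochner_Integration.integral_cong refl; simp)+
    ultimately show ?thesis by simp
  qed
  then have "AE z in circle_measure. cmod (\<phi> z) \<le> ?C"
    by (rule AE_bound_from_quadratic_forms[OF \<phi>])
  then have "linf_norm \<phi> \<le> ?C"
    by (rule linf_norm_le[OF Linf_measurable[OF \<phi>]])
  moreover have "?C \<le> linf_norm \<phi>"
    by (intro l2_operator_norm_le dual_trunc_toeplitz_norm_le[OF M \<phi>] l2_orth_L2 linf_norm_AE(2)[OF \<phi>] l2_orth_zero)
  ultimately show "?C = linf_norm \<phi>" by simp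
qed

end
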